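(* Let $n=2k$ with $k\geq 4$ an integer. Then the edge-forwarding index of the complement of the circulant graph $C_n(1,k)$ satisfies $$\frac{2(n+2)}{n-4}\leq \pi(\overline{C_n(1,k)})\leq 11.$$
   Context: For $S\subseteq\mathbb{Z}_n\setminus\{0\}$, the circulant graph $C_n(S)$ is the simple undirected graph with vertex set $\mathbb{Z}_n=\{0,1,\ldots,n-1\}$ and edge set $\{\{g,g+s\}: g\in\mathbb{Z}_n, s\in S\}$ (addition mod $n$); $C_n(1,k)$ means $C_n(\{1,k\})$. $\overline{\Gamma}$ denotes the complement of $\Gamma$. A routing $R$ of a connected graph $\Gamma$ on $n$ vertices is a set of $n(n-1)$ elementary (i.e. simple) paths $R(x,y)$, one from $x$ to $y$ for every ordered pair $(x,y)$ of distinct vertices. The load of an edge $e$ in $R$ is the number of paths of $R$ passing through $e$ (in either direction), and $\pi(\Gamma,R)$ is the maximum load over all edges of $\Gamma$. The edge-forwarding index is $\pi(\Gamma)=\min_R\pi(\Gamma,R)$, the minimum over all routings $R$ of $\Gamma$. *)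

theory Defs
  imports Complex_Main
begin

record 'a ugraph =
  verts :: "'a set"
  edges :: "'a set set"

definition complement :: "'a ugraph \<Rightarrow> 'a ugraph" where
  "complement \<Gamma> = \<lparr>verts = verts \<Gamma>,
     edges = {{u, v} | u v. u \<in> verts \<Gamma> \<and> v \<in> verts \<Gamma> \<and> u \<noteq> v \<and> {u, v} \<notin> edges \<Gamma>}\<rparr>"

text \<open>The group of integers modulo \<open>n\<close> is represented by the residues below \<open>n\<close>. The
  connection set \<open>S\<close> is meant to consist of nonzero residues, so that there are no loops.\<close>

definition circulant_graph :: "nat \<Rightarrow> nat set \<Rightarrow> nat ugraph" where
  "circulant_graph n S = \<lparr>verts = {0..<n},
     edges = {{g, (g + s) mod n} | g s. g \<in> {0..<n} \<and> s \<in> S}\<rparr>"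

text \<open>A path is given by the list of its vertices, both end vertices included.\<close>

definition path_edges :: "'a list \<Rightarrow> 'a set set" where
  "path_edges p = {{p ! i, p ! Suc i} | i. Suc i < length p}"

definition elementary_path :: "'a ugraph \<Rightarrow> 'a \<Rightarrow> 'a list \<Rightarrow> 'a \<Rightarrow> bool" where
  "elementary_path \<Gamma> x p y \<longleftrightarrow>
     p \<noteq> [] \<and> hd p = x \<and> last p = y \<and> distinct p \<and>
     set p \<subseteq> verts \<Gamma> \<and> path_edges p \<subseteq> edges \<Gamma>"

text \<open>Only the values \<open>R x y\<close> at distinct vertices \<open>x\<close>, \<open>y\<close> of the graph are relevant. Paths
  for different ordered pairs have different end points, so counting ordered pairs is the
  same as counting paths.\<close>

definition routing :: "'a ugraph \<Rightarrow> ('a \<Rightarrow> 'a \<Rightarrow> 'a list) \<Rightarrow> bool" where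
  "routing \<Gamma> R \<longleftrightarrow>
     (\<forall>x\<in>verts \<Gamma>. \<forall>y\<in>verts \<Gamma>. x \<noteq> y \<longrightarrow> elementary_path \<Gamma> x (R x y) y)"

definition edge_load :: "'a ugraph \<Rightarrow> ('a \<Rightarrow> 'a \<Rightarrow> 'a list) \<Rightarrow> 'a set \<Rightarrow> nat" where
  "edge_load \<Gamma> R e =
     card {(x, y). x \<in> verts \<Gamma> \<and> y \<in> verts \<Gamma> \<and> x \<noteq> y \<and> e \<in> path_edges (R x y)}"

definition max_edge_load :: "'a ugraph \<Rightarrow> ('a \<Rightarrow> 'a \<Rightarrow> 'a list) \<Rightarrow> nat" where
  "max_edge_load \<Gamma> R = Max (edge_load \<Gamma> R ` edges \<Gamma>)"

text \<open>An infimum of a nonempty set of natural numbers is attained, so this is a minimum. A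
  disconnected graph has no routing and gets the value \<open>0\<close>; hence a positive lower bound on
  the index also says that a routing exists.\<close>

definition edge_forwarding_index :: "'a ugraph \<Rightarrow> nat" where
  "edge_forwarding_index \<Gamma> = Inf {max_edge_load \<Gamma> R | R. routing \<Gamma> R}"

end

theory Submission
  imports Defs
begin

text \<open>
  Both bounds compare adjacent with nonadjacent ordered pairs of vertices.

  For the lower bound, a routing spends at least one edge on an adjacent pair and at least two
  on any other pair. On \<open>N\<close> vertices with \<open>q\<close> edges, exactly \<open>2 * q\<close> of the \<open>N * (N - 1)\<close>
  pairs are adjacent, so the loads of all edges add up to at least \<open>2 * N * (N - 1) - 2 * q\<close>,
  and some edge carries at least the average \<open>2 * N * (N - 1) / q - 2\<close>
  (\<open>max_edge_load_lower_bound\<close>). The circulant graph has \<open>3 * k\<close> edges, so its complement has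
  \<open>q = k * (2 * k - 1) - 3 * k = 2 * k * (k - 2)\<close>, and for \<open>N = n\<close> the average is
  \<open>2 * (n + 2) / (n - 4)\<close>.

  For the upper bound, adjacent pairs are joined by their edge and every other pair by two edges
  through a chosen midpoint. An edge used by such a detour contains its midpoint. If no vertex
  is the midpoint for more than \<open>c\<close> pairs, each edge therefore carries at most \<open>2 + 2 * c\<close>
  paths (\<open>edge_load_detour_le\<close>). In the complement of the circulant graph the nonadjacent
  pairs have difference \<open>1\<close>, \<open>-1\<close> or \<open>k\<close>. Choosing the midpoint as a translate of the first
  vertex that depends only on the difference makes each vertex the midpoint of one pair per
  difference, so \<open>c = 3\<close> and no load exceeds \<open>8\<close>.
\<close>

section \<open>A lower bound by counting total load\<close>

lemma finite_path_edges: "finite (path_edges p)"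
proof -
  have "path_edges p \<subseteq> (\<lambda>i. {p ! i, p ! Suc i}) ` {..<length p}"
    unfolding path_edges_def by auto
  then show ?thesis by (rule finite_subset) simp
qed

text \<open>The summand for adjacency turns the two cases, one edge or at least two edges, into a
  uniform bound, which can be summed over all pairs. A path between nonadjacent vertices has
  an inner vertex, and its first two edges differ because its vertices do.\<close>

lemma card_path_edges_elementary_path:
  assumes p: "elementary_path \<Gamma> x p y" and "x \<noteq> y"
  shows "2 \<le> card (path_edges p) + (if {x, y} \<in> edges \<Gamma> then 1 else 0)"
proof -
  have ne: "p \<noteq> []" and hd: "p ! 0 = x" and last: "p ! (length p - 1) = y"
    and dist: "distinct p" and sub: "path_edges p \<subseteq> edges \<Gamma>"
    using p by (auto simp: elementary_path_def hd_conv_nth last_conv_nth)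
  have "length p \<noteq> 0" "length p \<noteq> 1"
    using ne hd last \<open>x \<noteq> y\<close> by auto
  then have len: "2 \<le> length p" by linarith
  have first: "{p ! 0, p ! 1} \<in> path_edges p"
    using len unfolding path_edges_def by force
  show ?thesis
  proof (cases "{x, y} \<in> edges \<Gamma>")
    case True
    then show ?thesis
      using first finite_path_edges[of p] by (auto simp: Suc_le_eq card_gt_0_iff)
  next
    case False
    have "length p \<noteq> 2"
      using False first sub hd last by auto
    then have len3: "3 \<le> length p" using len by linarith
    have second: "{p ! 1, p ! 2} \<in> path_edges p"
      unfolding path_edges_def using len3 by (intro CollectI exI[of _ 1]) (simp add: numeral_2_eq_2)
    have "p ! 0 \<noteq> p ! 1" "p ! 0 \<noteq> p ! 2"
      using dist len3 ne nth_eq_iff_index_eq[of p 0 1] nth_eq_iff_index_eq[of p 0 2] by force+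
    then have "{p ! 0, p ! 1} \<noteq> {p ! 1, p ! 2}" by (auto simp: doubleton_eq_iff)
    then have "2 = card {{p ! 0, p ! 1}, {p ! 1, p ! 2}}" by simp
    also have "\<dots> \<le> card (path_edges p)"
      using first second finite_path_edges by (intro card_mono) auto
    finally show ?thesis by simp
  qed
qed

lemma card_doubleton_orientations: "card {(x, y). {x, y} = e} \<le> 2"
proof (cases "\<exists>u v. e = {u, v}")
  case True
  then obtain u v where e: "e = {u, v}" by blast
  have "card {(x, y). {x, y} = e} \<le> card {(u, v), (v, u)}"
    by (rule card_mono) (auto simp: e doubleton_eq_iff)
  also have "\<dots> \<le> 2"
    using card_length[of "[(u, v), (v, u)]"] by simp
  finally show ?thesis .
next
  case False
  then have "{(x, y). {x, y} = e} = {}" by blast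
  then show ?thesis by (metis card.empty zero_le)
qed

lemma finite_doubleton_orientations: "finite {(x, y). {x, y} = e}"
proof (cases "\<exists>u v. e = {u, v}")
  case True
  then obtain u v where e: "e = {u, v}" by blast
  have "{(x, y). {x, y} = e} \<subseteq> {(u, v), (v, u)}"
    by (auto simp: e doubleton_eq_iff)
  then show ?thesis by (rule finite_subset) simp
next
  case False
  then have "{(x, y). {x, y} = e} = {}" by blast
  then show ?thesis by (metis finite.emptyI)
qed

lemma card_adjacent_pairs_le:
  assumes "finite E"
  shows "card {(x, y). {x, y} \<in> E} \<le> 2 * card E"
proof -
  have "{(x, y). {x, y} \<in> E} = (\<Union>e\<in>E. {(x, y). {x, y} = e})" by auto
  also have "card \<dots> \<le> (\<Sum>e\<in>E. card {(x, y). {x, y} = e})"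
    using assms by (rule card_UN_le)
  also have "\<dots> \<le> (\<Sum>e\<in>E. 2)"
    by (intro sum_mono card_doubleton_orientations)
  finally show ?thesis by simp
qed

definition ordered_pairs :: "'a set \<Rightarrow> ('a \<times> 'a) set" where
  "ordered_pairs V = {(x, y). x \<in> V \<and> y \<in> V \<and> x \<noteq> y}"

lemma finite_ordered_pairs: "finite V \<Longrightarrow> finite (ordered_pairs V)"
  unfolding ordered_pairs_def by (rule finite_subset[of _ "V \<times> V"]) auto

lemma card_ordered_pairs:
  assumes "finite V"
  shows "card (ordered_pairs V) = card V * (card V - 1)"
proof -
  have "ordered_pairs V = Sigma V (\<lambda>x. V - {x})" by (auto simp: ordered_pairs_def)
  then show ?thesis using assms by simp
qed

lemma sum_edge_load:
  assumes "finite (verts \<Gamma>)" and fin: "finite (edges \<Gamma>)" and R: "routing \<Gamma> R"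
  shows "(\<Sum>e\<in>edges \<Gamma>. edge_load \<Gamma> R e) =
    (\<Sum>(x, y)\<in>ordered_pairs (verts \<Gamma>). card (path_edges (R x y)))"
proof -
  let ?P = "ordered_pairs (verts \<Gamma>)"
  have P: "finite ?P" using assms by (simp add: finite_ordered_pairs)
  have "edge_load \<Gamma> R e = (\<Sum>(x, y)\<in>?P. if e \<in> path_edges (R x y) then 1 else 0)" for e
  proof -
    have "edge_load \<Gamma> R e = card {p \<in> ?P. e \<in> path_edges (R (fst p) (snd p))}"
      unfolding edge_load_def ordered_pairs_def by (rule arg_cong[where f = card]) auto
    also have "\<dots> = (\<Sum>p\<in>?P. if e \<in> path_edges (R (fst p) (snd p)) then 1 else 0)"
      unfolding card_eq_sum using P by (rule sum.inter_filter)
    finally show ?thesis by (simp add: case_prod_beta)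
  qed
  then have "(\<Sum>e\<in>edges \<Gamma>. edge_load \<Gamma> R e) =
      (\<Sum>(x, y)\<in>?P. \<Sum>e\<in>edges \<Gamma>. if e \<in> path_edges (R x y) then 1 else 0)"
    by (simp add: case_prod_beta) (rule sum.swap)
  also have "\<dots> = (\<Sum>(x, y)\<in>?P. card (path_edges (R x y)))"
  proof (rule sum.cong[OF refl], clarify)
    fix x y assume "(x, y) \<in> ?P"
    then have "path_edges (R x y) \<subseteq> edges \<Gamma>"
      using R by (auto simp: routing_def elementary_path_def ordered_pairs_def)
    then have "edges \<Gamma> \<inter> {e. e \<in> path_edges (R x y)} = path_edges (R x y)" by auto
    then show "(\<Sum>e\<in>edges \<Gamma>. if e \<in> path_edges (R x y) then 1 else 0) = card (path_edges (R x y))"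
      using fin by (simp add: sum.If_cases)
  qed
  finally show ?thesis .
qed

text \<open>Summing the bound for single paths over all ordered pairs gives the total load plus the
  number of adjacent pairs. The factor is \<open>max_edge_load \<Gamma> R + 2\<close> because each edge accounts
  for its load and for its two orientations.\<close>

lemma max_edge_load_lower_bound:
  assumes V: "finite (verts \<Gamma>)" and E: "finite (edges \<Gamma>)" and R: "routing \<Gamma> R"
  shows "2 * (card (verts \<Gamma>) * (card (verts \<Gamma>) - 1))
    \<le> (max_edge_load \<Gamma> R + 2) * card (edges \<Gamma>)"
proof -
  let ?P = "ordered_pairs (verts \<Gamma>)"
  let ?a = "\<lambda>(x, y). if {x, y} \<in> edges \<Gamma> then 1 else 0 :: nat"
  have P: "finite ?P" using V by (rule finite_ordered_pairs)
  have "2 * (card (verts \<Gamma>) * (card (verts \<Gamma>) - 1)) = (\<Sum>p\<in>?P. 2)"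
    using V by (simp add: card_ordered_pairs)
  also have "\<dots> \<le> (\<Sum>p\<in>?P. (case p of (x, y) \<Rightarrow> card (path_edges (R x y))) + ?a p)"
  proof (rule sum_mono, clarify)
    fix x y assume "(x, y) \<in> ?P"
    then have "elementary_path \<Gamma> x (R x y) y" "x \<noteq> y"
      using R by (auto simp: routing_def ordered_pairs_def)
    from card_path_edges_elementary_path[OF this]
    show "2 \<le> card (path_edges (R x y)) + (if {x, y} \<in> edges \<Gamma> then 1 else 0)" .
  qed
  also have "\<dots> = (\<Sum>e\<in>edges \<Gamma>. edge_load \<Gamma> R e) + (\<Sum>p\<in>?P. ?a p)"
    using sum_edge_load[OF V E R] by (simp add: sum.distrib)
  also have "(\<Sum>e\<in>edges \<Gamma>. edge_load \<Gamma> R e) \<le> (\<Sum>e\<in>edges \<Gamma>. max_edge_load \<Gamma> R)"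
    unfolding max_edge_load_def using E by (intro sum_mono Max_ge) auto
  also have "(\<Sum>p\<in>?P. ?a p) = card {p \<in> ?P. {fst p, snd p} \<in> edges \<Gamma>}"
    unfolding card_eq_sum case_prod_beta using P by (rule sum.inter_filter[symmetric])
  also have "\<dots> \<le> card {(x, y). {x, y} \<in> edges \<Gamma>}"
  proof (rule card_mono)
    have "{(x, y). {x, y} \<in> edges \<Gamma>} = (\<Union>e\<in>edges \<Gamma>. {(x, y). {x, y} = e})" by auto
    then show "finite {(x, y). {x, y} \<in> edges \<Gamma>}"
      using E finite_doubleton_orientations by auto
  qed auto
  also have "\<dots> \<le> 2 * card (edges \<Gamma>)" using E by (rule card_adjacent_pairs_le)
  finally show ?thesis by (simp add: algebra_simps)
qed

section \<open>An upper bound from detours through a midpoint\<close>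

definition detour :: "'a ugraph \<Rightarrow> ('a \<Rightarrow> 'a \<Rightarrow> 'a) \<Rightarrow> 'a \<Rightarrow> 'a \<Rightarrow> 'a list" where
  "detour \<Gamma> m x y = (if {x, y} \<in> edges \<Gamma> then [x, y] else [x, m x y, y])"

lemma path_edges_pair: "path_edges [x, y] = {{x, y}}"
  by (auto simp: path_edges_def)

lemma path_edges_triple: "path_edges [x, z, y] = {{x, z}, {z, y}}"
proof -
  have "{i. Suc i < length [x, z, y]} = {0, 1}" by auto
  then show ?thesis unfolding path_edges_def setcompr_eq_image by simp
qed

lemma routing_detour:
  assumes "\<And>x y. x \<in> verts \<Gamma> \<Longrightarrow> y \<in> verts \<Gamma> \<Longrightarrow> x \<noteq> y \<Longrightarrow> {x, y} \<notin> edges \<Gamma> \<Longrightarrow>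
      m x y \<in> verts \<Gamma> - {x, y} \<and> {x, m x y} \<in> edges \<Gamma> \<and> {m x y, y} \<in> edges \<Gamma>"
  shows "routing \<Gamma> (detour \<Gamma> m)"
  unfolding routing_def
proof (intro ballI impI)
  fix x y assume xy: "x \<in> verts \<Gamma>" "y \<in> verts \<Gamma>" "x \<noteq> y"
  show "elementary_path \<Gamma> x (detour \<Gamma> m x y) y"
  proof (cases "{x, y} \<in> edges \<Gamma>")
    case True
    then show ?thesis using xy by (simp add: elementary_path_def detour_def path_edges_pair)
  next
    case False
    then show ?thesis using xy assms[OF xy]
      by (simp add: elementary_path_def detour_def path_edges_triple) metis
  qed
qed

text \<open>A path using \<open>e\<close> is either the edge \<open>e\<close> itself, in one of its two directions, or a detour
  whose midpoint is one of the two ends of \<open>e\<close>.\<close>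

lemma edge_load_detour_le:
  assumes V: "finite (verts \<Gamma>)" and e: "e \<subseteq> verts \<Gamma>" "card e \<le> 2"
    and c: "\<And>w. w \<in> verts \<Gamma> \<Longrightarrow>
      card {(x, y) \<in> ordered_pairs (verts \<Gamma>). {x, y} \<notin> edges \<Gamma> \<and> m x y = w} \<le> c"
  shows "edge_load \<Gamma> (detour \<Gamma> m) e \<le> 2 + 2 * c"
proof -
  let ?P = "ordered_pairs (verts \<Gamma>)"
  let ?M = "\<lambda>w. {(x, y) \<in> ?P. {x, y} \<notin> edges \<Gamma> \<and> m x y = w}"
  have fin: "finite e" using V e by (blast intro: finite_subset)
  have finM: "finite (?M w)" for w
    by (rule finite_subset[OF _ finite_ordered_pairs[OF V]]) auto
  have "edge_load \<Gamma> (detour \<Gamma> m) e \<le> card ({(x, y). {x, y} = e} \<union> (\<Union>w\<in>e. ?M w))"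
    unfolding edge_load_def
  proof (rule card_mono)
    show "finite ({(x, y). {x, y} = e} \<union> (\<Union>w\<in>e. ?M w))"
      using fin finM finite_doubleton_orientations[of e] by blast
  qed (auto simp: detour_def ordered_pairs_def path_edges_pair path_edges_triple split: if_splits)
  also have "\<dots> \<le> card {(x, y). {x, y} = e} + card (\<Union>w\<in>e. ?M w)"
    by (rule card_Un_le)
  also have "card (\<Union>w\<in>e. ?M w) \<le> (\<Sum>w\<in>e. card (?M w))"
    using fin by (rule card_UN_le)
  also have "\<dots> \<le> (\<Sum>w\<in>e. c)" using c e by (intro sum_mono) auto
  also have "\<dots> \<le> 2 * c" using e by simp
  finally show ?thesis using card_doubleton_orientations[of e] by linarith
qed

section \<open>The complement of the circulant graph\<close>

text \<open>A sum of two residues exceeds the modulus at most once, so residue conditions become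
  linear arithmetic.\<close>

lemma eq_residue_sum_iff:
  fixes u v s n :: nat
  assumes "u < n" "v < n" "s < n"
  shows "v = (u + s) mod n \<longleftrightarrow> v = u + s \<or> v + n = u + s"
proof (cases "u + s < n")
  case True
  then have eq: "(u + s) mod n = u + s" by simp
  show ?thesis unfolding eq using True assms by presburger
next
  case False
  then have eq: "(u + s) mod n = u + s - n"
    using assms by (simp add: mod_if)
  show ?thesis unfolding eq using False assms by presburger
qed

lemma circulant_adjacent_iff:
  assumes n: "n = 2 * k" and k: "k > 0" and "u < n" "v < n"
  shows "{u, v} \<in> edges (circulant_graph n {1, k}) \<longleftrightarrow>
    v = (u + 1) mod n \<or> u = (v + 1) mod n \<or> v = (u + k) mod n"
proof -
  \<comment> \<open>The difference \<open>k = n div 2\<close> is its own negative, so its direction does not matter.\<close>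
  have half: "u = (v + k) mod n \<longleftrightarrow> v = (u + k) mod n"
    using assms by (simp add: eq_residue_sum_iff) linarith
  have "{u, v} \<in> edges (circulant_graph n {1, k}) \<longleftrightarrow>
      (\<exists>g<n. {u, v} = {g, (g + 1) mod n} \<or> {u, v} = {g, (g + k) mod n})"
    unfolding circulant_graph_def ugraph.simps mem_Collect_eq atLeastLessThan_iff
    using le0 by blast
  also have "\<dots> \<longleftrightarrow> v = (u + 1) mod n \<or> u = (v + 1) mod n \<or> v = (u + k) mod n \<or> u = (v + k) mod n"
    using assms(3,4) by (auto simp: doubleton_eq_iff)
  finally show ?thesis using half by blast
qed

lemma complement_circulant_adjacent_iff:
  assumes n: "n = 2 * k" and k: "k > 0" and "u < n" "v < n"
  shows "{u, v} \<in> edges (complement (circulant_graph n {1, k})) \<longleftrightarrow>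
    u \<noteq> v \<and> v \<noteq> (u + 1) mod n \<and> u \<noteq> (v + 1) mod n \<and> v \<noteq> (u + k) mod n"
proof -
  have "{u, v} \<in> edges (complement (circulant_graph n {1, k})) \<longleftrightarrow>
      u \<noteq> v \<and> {u, v} \<notin> edges (circulant_graph n {1, k})"
    using assms(3,4)
    by (auto simp: complement_def circulant_graph_def doubleton_eq_iff insert_commute)
  then show ?thesis using circulant_adjacent_iff[OF assms] by blast
qed

lemma verts_complement_circulant: "verts (complement (circulant_graph n S)) = {..<n}"
  by (auto simp: complement_def circulant_graph_def)

lemma edges_complement:
  "edges (complement \<Gamma>) = {e. e \<subseteq> verts \<Gamma> \<and> card e = 2} - edges \<Gamma>"
  by (auto simp: complement_def card_2_iff)

text \<open>The cycle edges \<open>{g, g + 1}\<close> give \<open>2 * k\<close> edges and the diameters \<open>{g, g + k}\<close> only \<open>k\<close>,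
  since \<open>g\<close> and \<open>g + k\<close> yield the same diameter.\<close>

lemma card_edges_circulant_ge:
  assumes n: "n = 2 * k" and k: "k \<ge> 2"
  shows "3 * k \<le> card ({e. e \<subseteq> {0..<n} \<and> card e = 2} \<inter> edges (circulant_graph n {1, k}))"
proof -
  let ?A = "(\<lambda>g. {g, (g + 1) mod n}) ` {..<n}"
  let ?B = "(\<lambda>g. {g, g + k}) ` {..<k}"
  have suc: "Suc g mod n = (if g + 1 < n then g + 1 else 0)" if "g < n" for g
    using that by (auto simp: mod_if)
  have "n > 2" using assms by simp
  then have "inj_on (\<lambda>g. {g, (g + 1) mod n}) {..<n}"
    by (auto simp: inj_on_def suc doubleton_eq_iff split: if_splits)
  then have A: "card ?A = n" by (simp add: card_image)
  have "inj_on (\<lambda>g. {g, g + k}) {..<k}"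
    by (auto simp: inj_on_def doubleton_eq_iff)
  then have B: "card ?B = k" by (simp add: card_image)
  have "{g, (g + 1) mod n} \<noteq> {h, h + k}" if "g < n" "h < k" for g h
    using suc[OF that(1)] that assms by (auto simp: doubleton_eq_iff split: if_splits)
  then have "?A \<inter> ?B = {}" by auto
  then have "card (?A \<union> ?B) = 3 * k"
    using A B n by (simp add: card_Un_disjoint)
  moreover have "?A \<subseteq> {e. e \<subseteq> {0..<n} \<and> card e = 2} \<inter> edges (circulant_graph n {1, k})"
  proof
    fix e assume "e \<in> ?A"
    then obtain g where g: "g < n" and e: "e = {g, (g + 1) mod n}" by auto
    have g': "(g + 1) mod n < n" "g \<noteq> (g + 1) mod n"
      using g suc[OF g] assms by (auto split: if_splits)
    then have "e \<in> edges (circulant_graph n {1, k})"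
      using circulant_adjacent_iff[of n k g "(g + 1) mod n"] g n k e by simp
    moreover have "e \<subseteq> {0..<n}" "card e = 2" using g g' e by auto
    ultimately show "e \<in> {e. e \<subseteq> {0..<n} \<and> card e = 2} \<inter> edges (circulant_graph n {1, k})"
      by blast
  qed
  moreover have "?B \<subseteq> {e. e \<subseteq> {0..<n} \<and> card e = 2} \<inter> edges (circulant_graph n {1, k})"
  proof
    fix e assume "e \<in> ?B"
    then obtain g where g: "g < k" and e: "e = {g, g + k}" by auto
    have "g + k = (g + k) mod n" using g n by simp
    then have "e \<in> edges (circulant_graph n {1, k})"
      using circulant_adjacent_iff[of n k g "g + k"] g n e by simp
    moreover have "e \<subseteq> {0..<n}" "card e = 2" using g n e by auto
    ultimately show "e \<in> {e. e \<subseteq> {0..<n} \<and> card e = 2} \<inter> edges (circulant_graph n {1, k})"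
      by blast
  qed
  moreover have "finite {e. e \<subseteq> {0..<n} \<and> card e = 2}"
    by simp
  ultimately show ?thesis by (metis (no_types, lifting) Un_least card_mono finite_Int)
qed

lemma card_edges_complement_circulant_le:
  assumes n: "n = 2 * k" and k: "k \<ge> 2"
  shows "card (edges (complement (circulant_graph n {1, k}))) \<le> 2 * k * (k - 2)"
proof -
  let ?T = "{e. e \<subseteq> {0..<n} \<and> card e = 2}"
  have T: "card ?T = k * (2 * k - 1)"
    using n_subsets[of "{0..<n}" 2] n by (simp add: choose_two)
  have "edges (complement (circulant_graph n {1, k})) = ?T - edges (circulant_graph n {1, k})"
    unfolding edges_complement by (simp add: circulant_graph_def)
  then have "card (edges (complement (circulant_graph n {1, k}))) =
      card ?T - card (?T \<inter> edges (circulant_graph n {1, k}))"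
    by (simp add: card_Diff_subset_Int)
  also have "\<dots> \<le> k * (2 * k - 1) - 3 * k"
    using card_edges_circulant_ge[OF assms] T by linarith
  also have "\<dots> = 2 * k * (k - 2)"
    using k by (auto simp: le_iff_add algebra_simps)
  finally show ?thesis .
qed

text \<open>The midpoint of a nonadjacent pair writes the differences as
  \<open>1 = -2 + 3\<close>, \<open>-1 = 2 + (-3)\<close> and \<open>k = 2 + (k - 2)\<close>. For \<open>k \<ge> 4\<close> all the summands are
  differences of adjacent vertices; this fails for \<open>k = 3\<close>, where \<open>3\<close> is the diameter.
  The summand \<open>n - 2\<close> stands for \<open>-2\<close>.\<close>

definition circulant_midpoint :: "nat \<Rightarrow> nat \<Rightarrow> nat \<Rightarrow> nat" where
  "circulant_midpoint n x y = (if y = (x + 1) mod n then (x + (n - 2)) mod n else (x + 2) mod n)"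

lemma circulant_midpoint_adjacent:
  fixes n k :: nat
  defines "\<Gamma> \<equiv> complement (circulant_graph n {1, k})"
  assumes n: "n = 2 * k" and k: "k \<ge> 4" and x: "x < n" and y: "y < n" and "x \<noteq> y"
    and nonadj: "{x, y} \<notin> edges \<Gamma>"
  shows "circulant_midpoint n x y \<in> verts \<Gamma> - {x, y} \<and>
    {x, circulant_midpoint n x y} \<in> edges \<Gamma> \<and> {circulant_midpoint n x y, y} \<in> edges \<Gamma>"
proof -
  let ?z = "circulant_midpoint n x y"
  have adj: "{u, v} \<in> edges \<Gamma> \<longleftrightarrow>
      u \<noteq> v \<and> v \<noteq> (u + 1) mod n \<and> u \<noteq> (v + 1) mod n \<and> v \<noteq> (u + k) mod n"
    if "u < n" "v < n" for u v
    unfolding \<Gamma>_def using complement_circulant_adjacent_iff[OF n _ that] k by simp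
  have z: "?z < n" unfolding circulant_midpoint_def using n k by auto
  have cases: "y = (x + 1) mod n \<or> x = (y + 1) mod n \<or> y = (x + k) mod n"
    using nonadj adj[OF x y] \<open>x \<noteq> y\<close> by blast
  have "{x, ?z} \<in> edges \<Gamma> \<and> {?z, y} \<in> edges \<Gamma>"
  proof (cases "y = (x + 1) mod n")
    case True
    then have "?z = (x + (n - 2)) mod n" by (simp add: circulant_midpoint_def)
    then have "?z = x + (n - 2) \<or> ?z + n = x + (n - 2)"
      using eq_residue_sum_iff[of x n ?z "n - 2"] x z n k by simp
    moreover have "y = x + 1 \<or> y + n = x + 1"
      using True eq_residue_sum_iff[of x n y 1] x y n k by simp
    ultimately show ?thesis
      unfolding adj[OF x z] adj[OF z y]
      using eq_residue_sum_iff[of _ n _ 1] eq_residue_sum_iff[of _ n _ k] x y z n k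
      by simp linarith
  next
    case False
    then have "?z = (x + 2) mod n" by (simp add: circulant_midpoint_def)
    then have "?z = x + 2 \<or> ?z + n = x + 2"
      using eq_residue_sum_iff[of x n ?z 2] x z n k by simp
    moreover have "x = y + 1 \<or> x + n = y + 1 \<or> y = x + k \<or> y + n = x + k"
      using False cases eq_residue_sum_iff[of y n x 1] eq_residue_sum_iff[of x n y k] x y n k by auto
    ultimately show ?thesis
      unfolding adj[OF x z] adj[OF z y]
      using eq_residue_sum_iff[of _ n _ 1] eq_residue_sum_iff[of _ n _ k] x y z n k
      by simp linarith
  qed
  then show ?thesis
    using z adj[OF x z] adj[OF z y] unfolding \<Gamma>_def verts_complement_circulant by auto
qed

text \<open>The difference of a pair and its midpoint determine the pair: it is
  \<open>(w + 2, w + 3)\<close>, \<open>(w - 2, w - 3)\<close> or \<open>(w - 2, w - 2 + k)\<close>.\<close>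

lemma card_circulant_midpoint_le:
  fixes n k :: nat
  defines "\<Gamma> \<equiv> complement (circulant_graph n {1, k})"
  assumes n: "n = 2 * k" and k: "k \<ge> 4" and w: "w < n"
  shows "card {(x, y) \<in> ordered_pairs (verts \<Gamma>).
    {x, y} \<notin> edges \<Gamma> \<and> circulant_midpoint n x y = w} \<le> 3"
proof -
  let ?x = "(w + (n - 2)) mod n"
  let ?S = "{((w + 2) mod n, (w + 3) mod n), (?x, (w + (n - 3)) mod n), (?x, (?x + k) mod n)}"
  have sub: "(x, y) \<in> ?S" if xy: "x < n" "y < n" "x \<noteq> y" "{x, y} \<notin> edges \<Gamma>"
    and m: "circulant_midpoint n x y = w" for x y
  proof -
    note iff = eq_residue_sum_iff[of _ n]
    have cases: "y = (x + 1) mod n \<or> x = (y + 1) mod n \<or> y = (x + k) mod n"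
      using xy complement_circulant_adjacent_iff[OF n _ xy(1,2)] k unfolding \<Gamma>_def by auto
    show ?thesis
    proof (cases "y = (x + 1) mod n")
      case True
      then have w': "w = (x + (n - 2)) mod n" using m by (simp add: circulant_midpoint_def)
      have "w = x + (n - 2) \<or> w + n = x + (n - 2)"
        using w' iff[of x w "n - 2"] xy w n k by simp
      moreover have "y = x + 1 \<or> y + n = x + 1"
        using True iff[of x y 1] xy n k by simp
      ultimately have "x = w + 2 \<or> x + n = w + 2" "y = w + 3 \<or> y + n = w + 3"
        using xy(1,2) w n k by linarith+
      then have "x = (w + 2) mod n" "y = (w + 3) mod n"
        using iff[of w x 2] iff[of w y 3] xy w n k by simp_all
      then show ?thesis by simp
    next
      case False
      then have w': "w = (x + 2) mod n" using m by (simp add: circulant_midpoint_def)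
      have w2: "w = x + 2 \<or> w + n = x + 2"
        using w' iff[of x w 2] xy w n k by simp
      then have x': "x = ?x"
        using iff[of w x "n - 2"] xy w n k by simp linarith
      show ?thesis
      proof (cases "x = (y + 1) mod n")
        case True
        then have "x = y + 1 \<or> x + n = y + 1"
          using iff[of y x 1] xy n k by simp
        then have "y = (w + (n - 3)) mod n"
          using w2 iff[of w y "n - 3"] xy w n k by simp linarith
        then show ?thesis using x' by simp
      next
        case False
        then have "y = (x + k) mod n" using cases \<open>y \<noteq> (x + 1) mod n\<close> by blast
        then show ?thesis using x' by simp
      qed
    qed
  qed
  have "card {(x, y) \<in> ordered_pairs (verts \<Gamma>).
      {x, y} \<notin> edges \<Gamma> \<and> circulant_midpoint n x y = w} \<le> card ?S"
  proof (rule card_mono)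
    show "{(x, y) \<in> ordered_pairs (verts \<Gamma>).
      {x, y} \<notin> edges \<Gamma> \<and> circulant_midpoint n x y = w} \<subseteq> ?S"
      using sub unfolding \<Gamma>_def verts_complement_circulant ordered_pairs_def by blast
  qed simp
  also have "\<dots> \<le> 3"
    using card_length[of "[((w + 2) mod n, (w + 3) mod n), (?x, (w + (n - 3)) mod n), (?x, (?x + k) mod n)]"]
    by simp
  finally show ?thesis .
qed

theorem corollary4p2:
  fixes n k :: nat
  assumes "n = 2 * k" and "k \<ge> 4"
  shows "2 * (real n + 2) / (real n - 4)
           \<le> real (edge_forwarding_index (complement (circulant_graph n {1, k})))
       \<and> edge_forwarding_index (complement (circulant_graph n {1, k})) \<le> 11"
proof -
  define \<Gamma> where "\<Gamma> = complement (circulant_graph n {1, k})"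
  let ?L = "{max_edge_load \<Gamma> R | R. routing \<Gamma> R}"
  have V: "verts \<Gamma> = {..<n}" unfolding \<Gamma>_def by (rule verts_complement_circulant)
  have edges: "e \<subseteq> verts \<Gamma>" "card e = 2" if "e \<in> edges \<Gamma>" for e
    using that V unfolding \<Gamma>_def edges_complement by (auto simp: circulant_graph_def)
  have fin: "finite (edges \<Gamma>)"
    by (rule finite_subset[of _ "Pow (verts \<Gamma>)"]) (use edges V in auto)
  define R where "R = detour \<Gamma> (circulant_midpoint n)"
  have R: "routing \<Gamma> R"
    unfolding R_def using circulant_midpoint_adjacent[OF assms]
    by (intro routing_detour) (auto simp: V \<Gamma>_def verts_complement_circulant)
  then have L: "max_edge_load \<Gamma> R \<in> ?L" by blast
  have "edge_load \<Gamma> R e \<le> 8" if "e \<in> edges \<Gamma>" for e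
  proof -
    have "edge_load \<Gamma> R e \<le> 2 + 2 * 3"
      unfolding R_def
      by (rule edge_load_detour_le)
        (use V edges[OF that] card_circulant_midpoint_le[OF assms] in \<open>auto simp: \<Gamma>_def\<close>)
    then show ?thesis by simp
  qed
  moreover have "edges \<Gamma> \<noteq> {}"
    using complement_circulant_adjacent_iff[of n k 0 2] assms by (auto simp: \<Gamma>_def)
  ultimately have "max_edge_load \<Gamma> R \<le> 8"
    unfolding max_edge_load_def using fin by simp
  then have upper: "edge_forwarding_index \<Gamma> \<le> 8"
    unfolding edge_forwarding_index_def using L by (meson order_trans wellorder_Inf_le1)
  \<comment> \<open>Since a routing exists, the infimum is attained, and the lower bound for a single routing applies.\<close>
  have "edge_forwarding_index \<Gamma> \<in> ?L"
    unfolding edge_forwarding_index_def using L by (intro Inf_nat_def1) blast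
  then obtain R' where R': "routing \<Gamma> R'" "edge_forwarding_index \<Gamma> = max_edge_load \<Gamma> R'"
    by blast
  let ?f = "edge_forwarding_index \<Gamma>"
  have "2 * (n * (n - 1)) \<le> (?f + 2) * card (edges \<Gamma>)"
    using max_edge_load_lower_bound[OF _ fin R'(1)] R'(2) V by simp
  also have "\<dots> \<le> (?f + 2) * (2 * k * (k - 2))"
    using card_edges_complement_circulant_le[of n k] assms by (intro mult_left_mono) (auto simp: \<Gamma>_def)
  finally have "2 * k * (2 * (n - 1)) \<le> 2 * k * ((?f + 2) * (k - 2))"
    using assms by (simp add: algebra_simps)
  then have "2 * (n - 1) \<le> (?f + 2) * (k - 2)"
    using assms by simp
  then have "real (2 * (n - 1)) \<le> real ((?f + 2) * (k - 2))"
    by (simp only: of_nat_le_iff)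
  moreover have "real (n - 1) = real n - 1" "real (k - 2) = real k - 2"
    using assms by (simp_all add: of_nat_diff)
  ultimately have "2 * (real n - 1) \<le> (real ?f + 2) * (real k - 2)"
    by (simp only: of_nat_mult of_nat_add of_nat_numeral)
  then have "2 * (real n + 2) / (real n - 4) \<le> real ?f"
    using assms by (simp add: field_simps)
  then show ?thesis using upper unfolding \<Gamma>_def by simp
qed

end
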